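(* Let $M$ be a matroid. The motivic zeta functions $Z_M(q,T)$, $Z_M^0(q,T)$, and $\overline{Z}_M(q,T)$ are all rational functions in $q$ and $T$.
   Context: Let $M$ be a matroid on a finite non-empty ground set $E$ with rank function $\operatorname{rk}$. Its characteristic polynomial is $\chi_M(q)=\sum_{S\subseteq E}(-1)^{\#S}q^{\operatorname{rk}M-\operatorname{rk}S}$ and its reduced characteristic polynomial is $\overline{\chi}_M(q)=\chi_M(q)/(q-1)$. For $w=(w_e)\in\mathbb{R}^E$ set $\operatorname{wt}_M(w)=\max_{B\text{ basis of }M}\sum_{e\in B}w_e$, let $M_w$ be the matroid on $E$ whose bases are the bases $B$ of $M$ attaining this maximum, and set $|w|=\sum_e w_e$. For $v\in\mathbb{R}^E/\mathbb{R}\mathbf{1}$ with any lift $w$, set $\overline{\operatorname{wt}}_M(v)=\operatorname{wt}_M(w)-(\operatorname{rk}M)\min(w)$, $\overline{|v|}=|w|-(\#E)\min(w)$, and $M_v=M_w$. The motivic zeta function is $Z_M(q,T)=\sum_{w\in\mathbb{Z}_{\ge0}^E}\chi_{M_w}(q)q^{-\operatorname{rk}M-\operatorname{wt}_M(w)}T^{|w|}$, the local motivic zeta function $Z_M^0(q,T)$ is the same sum over $w\in\mathbb{Z}_{>0}^E$, and the reduced motivic zeta function is $\overline{Z}_M(q,T)=\sum_{v\in\mathbb{Z}^E/\mathbb{Z}\mathbf{1}}\overline{\chi}_{M_v}(q)q^{-(\operatorname{rk}M-1)-\overline{\operatorname{wt}}_M(v)}T^{\overline{|v|}}$, all in $\mathbb{Z}[q^{\pm1}]\llbracket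 T\rrbracket$. *)

theory Defs
  imports "HOL-Library.Poly_Mapping" "HOL-Library.FuncSet"
    "HOL-Computational_Algebra.Computational_Algebra"
begin

section \<open>Matroids\<close>

record 'a basis_system =
  ground :: "'a set"
  bases :: "'a set set"

definition matroid :: "'a basis_system \<Rightarrow> bool" where
  "matroid M \<longleftrightarrow>
     finite (ground M) \<and> bases M \<noteq> {} \<and> bases M \<subseteq> Pow (ground M) \<and>
     (\<forall>A\<in>bases M. \<forall>B\<in>bases M. \<forall>x\<in>A - B. \<exists>y\<in>B - A. insert y (A - {x}) \<in> bases M)"

definition indep :: "'a basis_system \<Rightarrow> 'a set \<Rightarrow> bool" where
  "indep M I \<longleftrightarrow> (\<exists>B\<in>bases M. I \<subseteq> B)"

definition rk :: "'a basis_system \<Rightarrow> 'a set \<Rightarrow> nat" where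
  "rk M S = Max (card ` {I. I \<subseteq> S \<and> indep M I})"

abbreviation rank :: "'a basis_system \<Rightarrow> nat" where
  "rank M \<equiv> rk M (ground M)"

definition char_poly :: "'a basis_system \<Rightarrow> int poly" where
  "char_poly M = (\<Sum>S\<in>Pow (ground M). monom ((-1) ^ card S) (rank M - rk M S))"

text \<open>The division is exact, see \<open>reduced_char_poly\<close> below.\<close>

definition red_char_poly :: "'a basis_system \<Rightarrow> int poly" where
  "red_char_poly M = char_poly M div [:-1, 1:]"

text \<open>
  Weights take values in an arbitrary ordered integral domain, so that real weights and the
  integral ones that occur in the zeta functions are covered at once.
\<close>

definition wt :: "'a basis_system \<Rightarrow> ('a \<Rightarrow> 'b::linordered_idom) \<Rightarrow> 'b" where
  "wt M w = Max ((\<lambda>B. \<Sum>e\<in>B. w e) ` bases M)"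

definition initial :: "'a basis_system \<Rightarrow> ('a \<Rightarrow> 'b::linordered_idom) \<Rightarrow> 'a basis_system" where
  "initial M w = M\<lparr>bases := {B \<in> bases M. (\<Sum>e\<in>B. w e) = wt M w}\<rparr>"

section \<open>Integral weights modulo the all-ones vector\<close>

definition shift_rel :: "'a set \<Rightarrow> (('a \<Rightarrow> int) \<times> ('a \<Rightarrow> int)) set" where
  "shift_rel E = {(w, w'). w \<in> E \<rightarrow>\<^sub>E UNIV \<and> w' \<in> E \<rightarrow>\<^sub>E UNIV \<and> (\<exists>c. \<forall>e\<in>E. w' e = w e + c)}"

definition weights_mod_ones :: "'a set \<Rightarrow> ('a \<Rightarrow> int) set set" where
  "weights_mod_ones E = (E \<rightarrow>\<^sub>E UNIV) // shift_rel E"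

text \<open>The quantities below do not depend on the chosen lift, see \<open>lift_independent\<close>.\<close>

definition lift :: "('a \<Rightarrow> int) set \<Rightarrow> 'a \<Rightarrow> int" where
  "lift v = (SOME w. w \<in> v)"

definition red_wt :: "'a basis_system \<Rightarrow> ('a \<Rightarrow> int) set \<Rightarrow> int" where
  "red_wt M v = wt M (lift v) - int (rank M) * Min (lift v ` ground M)"

definition red_size :: "'a set \<Rightarrow> ('a \<Rightarrow> int) set \<Rightarrow> int" where
  "red_size E v = (\<Sum>e\<in>E. lift v e) - int (card E) * Min (lift v ` E)"

section \<open>Laurent polynomials and the zeta functions\<close>

text \<open>The group ring of the integers, that is, the Laurent polynomials in \<open>q\<close>.\<close>

type_synonym laurent = "int \<Rightarrow>\<^sub>0 int"

definition qpow :: "int \<Rightarrow> laurent" where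
  "qpow k = Poly_Mapping.single k 1"

definition laurent_of_poly :: "int poly \<Rightarrow> laurent" where
  "laurent_of_poly p = (\<Sum>i\<le>Polynomial.degree p. Poly_Mapping.single (int i) (Polynomial.coeff p i))"

definition zeta_sum :: "'a basis_system \<Rightarrow> int set \<Rightarrow> laurent fps" where
  "zeta_sum M N = Abs_fps (\<lambda>n.
     \<Sum>w | w \<in> ground M \<rightarrow>\<^sub>E N \<and> (\<Sum>e\<in>ground M. w e) = int n.
       laurent_of_poly (char_poly (initial M w)) * qpow (- int (rank M) - wt M w))"

definition motivic_zeta :: "'a basis_system \<Rightarrow> laurent fps" where
  "motivic_zeta M = zeta_sum M {0..}"

definition local_motivic_zeta :: "'a basis_system \<Rightarrow> laurent fps" where
  "local_motivic_zeta M = zeta_sum M {0<..}"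

definition red_motivic_zeta :: "'a basis_system \<Rightarrow> laurent fps" where
  "red_motivic_zeta M = Abs_fps (\<lambda>n.
     \<Sum>v | v \<in> weights_mod_ones (ground M) \<and> red_size (ground M) v = int n.
       laurent_of_poly (red_char_poly (initial M (lift v)))
         * qpow (- (int (rank M) - 1) - red_wt M v))"

text \<open>
  Polynomials in two variables are nested: the outer variable is \<open>T\<close>, the inner one is \<open>q\<close>.
\<close>

definition series_of_poly :: "int poly poly \<Rightarrow> laurent fps" where
  "series_of_poly P = fps_of_poly (map_poly laurent_of_poly P)"

definition rational_in_q_T :: "laurent fps \<Rightarrow> bool" where
  "rational_in_q_T F \<longleftrightarrow>
     (\<exists>P D. D \<noteq> 0 \<and> series_of_poly D * F = series_of_poly P)"

section \<open>The definitions make sense\<close>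

lemma lookup_laurent_of_poly:
  "Poly_Mapping.lookup (laurent_of_poly p) k = (if k < 0 then 0 else Polynomial.coeff p (nat k))"
proof -
  have "Poly_Mapping.lookup (laurent_of_poly p) k =
      (\<Sum>i\<le>Polynomial.degree p. if int i = k then Polynomial.coeff p i else 0)"
    by (simp add: laurent_of_poly_def lookup_sum lookup_single when_def)
  also have "\<dots> = (if k < 0 then 0 else Polynomial.coeff p (nat k))"
  proof (cases "k < 0")
    case True
    then show ?thesis by (auto intro!: sum.neutral)
  next
    case False
    then have "int i = k \<longleftrightarrow> i = nat k" for i by auto
    then show ?thesis using False by (auto simp: coeff_eq_0)
  qed
  finally show ?thesis .
qed

lemma reduced_char_poly:
  assumes "finite (ground M)" "ground M \<noteq> {}"
  shows "char_poly M = [:-1, 1:] * red_char_poly M"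
proof -
  obtain a where a: "a \<in> ground M" using assms by blast
  define X where "X = ground M - {a}"
  have X: "finite X" "a \<notin> X" "ground M = insert a X"
    using assms a by (auto simp: X_def)
  have "poly (char_poly M) 1 = (\<Sum>S\<in>Pow (insert a X). (-1) ^ card S)"
    by (simp add: char_poly_def poly_sum poly_monom X(3))
  also have "\<dots> = (\<Sum>S\<in>Pow X. (-1) ^ card S) + (\<Sum>S\<in>insert a ` Pow X. (-1) ^ card S)"
    unfolding Pow_insert using X by (intro sum.union_disjoint) auto
  also have "(\<Sum>S\<in>insert a ` Pow X. (-1) ^ card S) = (\<Sum>S\<in>Pow X. (-1) ^ card (insert a S) :: int)"
    using X by (subst sum.reindex) (auto simp: inj_on_def)
  also have "\<dots> = - (\<Sum>S\<in>Pow X. (-1) ^ card S)"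
    unfolding sum_negf[symmetric]
  proof (rule sum.cong[OF refl])
    fix S assume "S \<in> Pow X"
    then have "finite S" "a \<notin> S" using X finite_subset by auto
    then show "(-1) ^ card (insert a S) = - ((-1) ^ card S :: int)" by simp
  qed
  finally have "poly (char_poly M) 1 = 0" by simp
  then have "[:-1, 1:] dvd char_poly M" by (simp add: poly_eq_0_iff_dvd)
  then show ?thesis unfolding red_char_poly_def by (rule dvd_mult_div_cancel[symmetric])
qed

lemma finite_zeta_index:
  assumes "finite E" "N \<subseteq> {0..}"
  shows "finite {w. w \<in> E \<rightarrow>\<^sub>E N \<and> (\<Sum>e\<in>E. w e) = int n}"
proof (rule finite_subset)
  show "{w. w \<in> E \<rightarrow>\<^sub>E N \<and> (\<Sum>e\<in>E. w e) = int n} \<subseteq> E \<rightarrow>\<^sub>E {0..int n}"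
  proof clarify
    fix w assume w: "w \<in> E \<rightarrow>\<^sub>E N" "(\<Sum>e\<in>E. w e) = int n"
    have nonneg: "0 \<le> w e" if "e \<in> E" for e using w(1) that assms(2) by fastforce
    have "w e \<le> int n" if "e \<in> E" for e
      using member_le_sum[of e E w] nonneg that assms(1) w(2) by auto
    then show "w \<in> E \<rightarrow>\<^sub>E {0..int n}" using w(1) nonneg by (auto simp: PiE_iff)
  qed
qed (use assms in \<open>auto intro: finite_PiE\<close>)

lemma lift_in:
  assumes "v \<in> weights_mod_ones E"
  shows "lift v \<in> v"
proof -
  obtain w where w: "w \<in> E \<rightarrow>\<^sub>E UNIV" "v = shift_rel E `` {w}"
    using assms by (auto simp: weights_mod_ones_def elim: quotientE)
  then have "w \<in> v" by (auto simp: shift_rel_def intro: exI[of _ 0])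
  then show ?thesis unfolding lift_def by (rule someI[of "\<lambda>w. w \<in> v"])
qed

lemma equiv_shift_rel: "equiv (E \<rightarrow>\<^sub>E UNIV) (shift_rel E)"
proof (rule equivI)
  show "shift_rel E \<subseteq> (E \<rightarrow>\<^sub>E UNIV) \<times> (E \<rightarrow>\<^sub>E UNIV)" by (auto simp: shift_rel_def)
  show "refl_on (E \<rightarrow>\<^sub>E UNIV) (shift_rel E)"
    by (auto simp: refl_on_def shift_rel_def intro: exI[of _ 0])
  show "sym (shift_rel E)"
  proof (rule symI)
    fix w w' assume a: "(w, w') \<in> shift_rel E"
    then obtain c where "\<forall>e\<in>E. w' e = w e + c" by (auto simp: shift_rel_def)
    then have "\<forall>e\<in>E. w e = w' e + (- c)" by simp
    then show "(w', w) \<in> shift_rel E" using a unfolding shift_rel_def by blast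
  qed
  show "trans (shift_rel E)"
  proof (rule transI)
    fix w w' w'' assume a: "(w, w') \<in> shift_rel E" "(w', w'') \<in> shift_rel E"
    then obtain c d where "\<forall>e\<in>E. w' e = w e + c" "\<forall>e\<in>E. w'' e = w' e + d"
      unfolding shift_rel_def by blast
    then have "\<forall>e\<in>E. w'' e = w e + (c + d)" by simp
    then show "(w, w'') \<in> shift_rel E" using a unfolding shift_rel_def by blast
  qed
qed

lemma lift_shift:
  assumes "v \<in> weights_mod_ones E" "w \<in> v"
  obtains c where "\<forall>e\<in>E. lift v e = w e + c"
proof -
  have "(w, lift v) \<in> shift_rel E"
    using quotient_eq_iff[OF equiv_shift_rel, of v E v w "lift v"] assms lift_in[OF assms(1)]
    unfolding weights_mod_ones_def by blast
  then show ?thesis using that by (auto simp: shift_rel_def)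
qed

lemma basis_card_le:
  assumes M: "matroid M" and "A \<in> bases M" "B \<in> bases M"
  shows "card A \<le> card B"
  using assms(2,3)
proof (induction "card (A - B)" arbitrary: A)
  case 0
  have "finite A" "finite B"
    using M 0 unfolding matroid_def by (meson PowD finite_subset subsetD)+
  then show ?case using 0 by (simp add: card_mono)
next
  case (Suc n)
  have fin: "finite A" "finite B"
    using M Suc unfolding matroid_def by (meson PowD finite_subset subsetD)+
  obtain x where x: "x \<in> A - B" using Suc(2) by (metis card.empty ex_in_conv nat.distinct(1))
  then obtain y where y: "y \<in> B - A" "insert y (A - {x}) \<in> bases M"
    using M Suc.prems unfolding matroid_def by meson
  have "insert y (A - {x}) - B = (A - B) - {x}" using y by auto
  then have "n = card (insert y (A - {x}) - B)" using Suc(2) x fin by simp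
  from Suc(1)[OF this y(2) Suc.prems(2)] show ?case
    using x y fin by (simp add: card_Suc_Diff1)
qed

lemma rank_eq_card_basis:
  assumes M: "matroid M" and B: "B \<in> bases M"
  shows "rank M = card B"
  unfolding rk_def
proof (rule Max_eqI)
  have fin: "finite (ground M)" using M by (simp add: matroid_def)
  show "finite (card ` {I. I \<subseteq> ground M \<and> indep M I})"
    using fin by (auto intro!: finite_imageI finite_subset[of _ "Pow (ground M)"])
  show "card B \<in> card ` {I. I \<subseteq> ground M \<and> indep M I}"
    using M B unfolding matroid_def indep_def by blast
  fix k assume "k \<in> card ` {I. I \<subseteq> ground M \<and> indep M I}"
  then obtain I A where "k = card I" "A \<in> bases M" "I \<subseteq> A" by (auto simp: indep_def)
  moreover from this have "finite A"
    using M fin unfolding matroid_def by (meson PowD finite_subset subsetD)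
  ultimately show "k \<le> card B" using basis_card_le[OF M _ B] card_mono le_trans by metis
qed

lemma weight_shift:
  fixes w w' :: "'a \<Rightarrow> 'b::linordered_idom"
  assumes M: "matroid M" and w': "\<forall>e\<in>ground M. w' e = w e + c"
  shows "wt M w' = wt M w + of_nat (rank M) * c" and "initial M w' = initial M w"
proof -
  have s: "(\<Sum>e\<in>B. w' e) = (\<Sum>e\<in>B. w e) + of_nat (rank M) * c" if "B \<in> bases M" for B
  proof -
    have "B \<subseteq> ground M" using M that by (auto simp: matroid_def)
    then have "(\<Sum>e\<in>B. w' e) = (\<Sum>e\<in>B. w e + c)" using w' by (intro sum.cong) auto
    then show ?thesis by (simp add: sum.distrib rank_eq_card_basis[OF M that])
  qed
  have fin: "finite (bases M)" "bases M \<noteq> {}"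
    using M by (auto simp: matroid_def intro: finite_subset[of _ "Pow (ground M)"])
  have "wt M w' = Max ((\<lambda>B. (\<Sum>e\<in>B. w e) + of_nat (rank M) * c) ` bases M)"
    unfolding wt_def using s by (intro arg_cong[of _ _ Max] image_cong) auto
  also have "\<dots> = wt M w + of_nat (rank M) * c"
    unfolding wt_def using fin by (rule Max_add_commute)
  finally show 1: "wt M w' = wt M w + of_nat (rank M) * c" .
  show "initial M w' = initial M w"
    unfolding initial_def 1 using s by (intro arg_cong[of _ _ "\<lambda>X. M\<lparr>bases := X\<rparr>"]) auto
qed

lemma lift_independent:
  assumes M: "matroid M" and E: "ground M \<noteq> {}"
    and v: "v \<in> weights_mod_ones (ground M)" and w: "w \<in> v"
  shows "red_wt M v = wt M w - int (rank M) * Min (w ` ground M)"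
    and "red_size (ground M) v = (\<Sum>e\<in>ground M. w e) - int (card (ground M)) * Min (w ` ground M)"
    and "initial M (lift v) = initial M w"
proof -
  obtain c where c: "\<forall>e\<in>ground M. lift v e = w e + c" using lift_shift[OF v w] .
  have fin: "finite (ground M)" using M by (simp add: matroid_def)
  have "lift v ` ground M = (\<lambda>e. w e + c) ` ground M" using c by auto
  then have m: "Min (lift v ` ground M) = Min (w ` ground M) + c"
    using Min_add_commute[OF fin E] by simp
  show "red_wt M v = wt M w - int (rank M) * Min (w ` ground M)"
    using weight_shift(1)[OF M c] m by (simp add: red_wt_def algebra_simps)
  have "(\<Sum>e\<in>ground M. lift v e) = (\<Sum>e\<in>ground M. w e + c)" using c by (intro sum.cong) auto
  then show "red_size (ground M) v =
      (\<Sum>e\<in>ground M. w e) - int (card (ground M)) * Min (w ` ground M)"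
    using m by (simp add: red_size_def sum.distrib algebra_simps)
  show "initial M (lift v) = initial M w" using weight_shift(2)[OF M c] .
qed

lemma finite_red_zeta_index:
  assumes fin: "finite E" and E: "E \<noteq> {}"
  shows "finite {v. v \<in> weights_mod_ones E \<and> red_size E v = int n}"
proof (rule finite_subset)
  let ?W = "{w. w \<in> E \<rightarrow>\<^sub>E {0..} \<and> (\<Sum>e\<in>E. w e) = int n}"
  show "finite ((\<lambda>w. shift_rel E `` {w}) ` ?W)"
    using finite_zeta_index[OF fin, of "{0..}"] by auto
  show "{v. v \<in> weights_mod_ones E \<and> red_size E v = int n} \<subseteq> (\<lambda>w. shift_rel E `` {w}) ` ?W"
  proof clarify
    fix v assume v: "v \<in> weights_mod_ones E" "red_size E v = int n"
    define m where "m = Min (lift v ` E)"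
    define w where "w = restrict (\<lambda>e. lift v e - m) E"
    have l: "lift v \<in> v" using lift_in[OF v(1)] .
    have "v \<subseteq> E \<rightarrow>\<^sub>E UNIV"
      using v(1) in_quotient_imp_subset[OF equiv_shift_rel] by (simp add: weights_mod_ones_def)
    then have "(lift v, w) \<in> shift_rel E"
      using l by (auto simp: shift_rel_def w_def intro!: exI[of _ "- m"])
    moreover have "v = shift_rel E `` {lift v}"
      using v(1) l Image_singleton_iff equiv_class_eq[OF equiv_shift_rel]
      unfolding weights_mod_ones_def by (metis quotientE)
    ultimately have "v = shift_rel E `` {w}"
      using equiv_class_eq[OF equiv_shift_rel] by metis
    moreover have "w \<in> ?W"
    proof -
      have "0 \<le> lift v e - m" if "e \<in> E" for e using fin that by (simp add: m_def)
      moreover have "(\<Sum>e\<in>E. w e) = (\<Sum>e\<in>E. lift v e - m)"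
        unfolding w_def by (intro sum.cong) auto
      ultimately show ?thesis
        using v(2) by (auto simp: w_def red_size_def m_def sum_subtractf)
    qed
    ultimately show "v \<in> (\<lambda>w. shift_rel E `` {w}) ` ?W" by blast
  qed
qed

end

(*
  Group the weights w by the chain C of their nonempty superlevel sets.  Writing w = 1_F + w', where
  F is the support of w, an exchange argument gives a basis that is maximal for 1_F and w' at once.
  Hence the weight of M is additive, wt(w) = wt(1_F) + wt(w'), and M_w depends on C only.  So it
  suffices that the series G_C, the sum of q^(-wt(w)) T^|w| over the w with chain C, is rational.
  The chain of w' is C or C - {F}, hence q^wt(1_F) G_C = T^|F| (G_C + G_(C - {F})), and induction on
  C applies.  The local zeta function collects the chains that contain the ground set; the reduced
  one, computed with representatives of minimum 0, collects those that do not.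
*)

theory Submission
  imports Defs
begin

section \<open>Rational series\<close>

lemma laurent_of_poly_0 [simp]: "laurent_of_poly 0 = 0"
  by (simp add: laurent_of_poly_def)

lemma laurent_of_poly_1 [simp]: "laurent_of_poly 1 = 1"
  by (simp add: laurent_of_poly_def)

lemma laurent_of_poly_add: "laurent_of_poly (p + r) = laurent_of_poly p + laurent_of_poly r"
  by (rule poly_mapping_eqI) (simp add: lookup_add lookup_laurent_of_poly)

lemma laurent_of_poly_minus: "laurent_of_poly (- p) = - laurent_of_poly p"
  by (rule poly_mapping_eqI) (simp add: lookup_laurent_of_poly)

lemma laurent_of_poly_sum: "laurent_of_poly (\<Sum>i\<in>A. f i) = (\<Sum>i\<in>A. laurent_of_poly (f i))"
  by (induction A rule: infinite_finite_induct) (simp_all add: laurent_of_poly_add)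

lemma laurent_of_poly_monom: "laurent_of_poly (monom a n) = Poly_Mapping.single (int n) a"
  by (rule poly_mapping_eqI) (auto simp: lookup_laurent_of_poly lookup_single when_def)

text \<open>Multiplicativity is obtained one factor at a time: here \<open>p\<close> is expanded
  into monomials, and \<open>laurent_of_poly_mult\<close> then expands the other factor.\<close>

lemma laurent_of_poly_monom_mult:
  "laurent_of_poly (monom a n * p) = Poly_Mapping.single (int n) a * laurent_of_poly p"
proof -
  have "monom a n * p = (\<Sum>i\<le>Polynomial.degree p. monom (a * Polynomial.coeff p i) (n + i))"
    by (subst (1) poly_as_sum_of_monoms[symmetric]) (simp add: sum_distrib_left mult_monom)
  then show ?thesis
    by (simp add: laurent_of_poly_sum laurent_of_poly_monom laurent_of_poly_def[of p]
        sum_distrib_left mult_single)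
qed

lemma laurent_of_poly_mult: "laurent_of_poly (p * r) = laurent_of_poly p * laurent_of_poly r"
proof -
  have "p * r = (\<Sum>i\<le>Polynomial.degree p. monom (Polynomial.coeff p i) i * r)"
    by (subst (1) poly_as_sum_of_monoms[symmetric]) (simp add: sum_distrib_right)
  then show ?thesis
    by (simp add: laurent_of_poly_sum laurent_of_poly_monom_mult laurent_of_poly_def[of p]
        sum_distrib_right)
qed

lemma qpow_0 [simp]: "qpow 0 = 1"
  by (simp add: qpow_def)

lemma qpow_add: "qpow (i + j) = qpow i * qpow j"
  by (simp add: qpow_def mult_single)

lemma series_of_poly_nth [simp]:
  "fps_nth (series_of_poly P) n = laurent_of_poly (Polynomial.coeff P n)"
  by (simp add: series_of_poly_def coeff_map_poly)

lemma series_of_poly_add: "series_of_poly (P + R) = series_of_poly P + series_of_poly R"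
  by (rule fps_ext) (simp add: laurent_of_poly_add)

lemma series_of_poly_minus: "series_of_poly (- P) = - series_of_poly P"
  by (rule fps_ext) (simp add: laurent_of_poly_minus)

lemma series_of_poly_mult: "series_of_poly (P * R) = series_of_poly P * series_of_poly R"
  by (rule fps_ext)
    (simp add: fps_mult_nth coeff_mult laurent_of_poly_sum laurent_of_poly_mult atLeast0AtMost)

lemma series_of_poly_monom: "series_of_poly (monom p n) = fps_const (laurent_of_poly p) * fps_X ^ n"
  by (rule fps_ext) simp

lemma series_of_poly_const: "series_of_poly [:p:] = fps_const (laurent_of_poly p)"
  using series_of_poly_monom[of p 0] by (simp add: monom_0)

section \<open>Closure properties of rational series\<close>

lemma rational_in_q_T_series_of_poly: "rational_in_q_T (series_of_poly P)"
  unfolding rational_in_q_T_def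
  by (rule exI[of _ P], rule exI[of _ 1]) (simp flip: series_of_poly_mult)

lemma rational_in_q_T_add:
  assumes "rational_in_q_T F" "rational_in_q_T G"
  shows "rational_in_q_T (F + G)"
proof -
  obtain P D P' D' where *: "D \<noteq> 0" "series_of_poly D * F = series_of_poly P"
    "D' \<noteq> 0" "series_of_poly D' * G = series_of_poly P'"
    using assms unfolding rational_in_q_T_def by blast
  have "series_of_poly (D * D') * (F + G) =
      series_of_poly D' * (series_of_poly D * F) + series_of_poly D * (series_of_poly D' * G)"
    by (simp add: series_of_poly_mult algebra_simps)
  also have "\<dots> = series_of_poly (D' * P + D * P')"
    unfolding * by (simp add: series_of_poly_mult series_of_poly_add)
  finally show ?thesis using * unfolding rational_in_q_T_def by (metis no_zero_divisors)
qed

lemma rational_in_q_T_mult: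
  assumes "rational_in_q_T F" "rational_in_q_T G"
  shows "rational_in_q_T (F * G)"
proof -
  obtain P D P' D' where *: "D \<noteq> 0" "series_of_poly D * F = series_of_poly P"
    "D' \<noteq> 0" "series_of_poly D' * G = series_of_poly P'"
    using assms unfolding rational_in_q_T_def by blast
  have "series_of_poly (D * D') * (F * G) = (series_of_poly D * F) * (series_of_poly D' * G)"
    by (simp add: series_of_poly_mult algebra_simps)
  also have "\<dots> = series_of_poly (P * P')"
    unfolding * by (simp add: series_of_poly_mult)
  finally show ?thesis using * unfolding rational_in_q_T_def by (metis no_zero_divisors)
qed

text \<open>The product of \<open>D\<close> and a denominator of \<open>G\<close> is a denominator
  of \<open>F\<close>. In this way a linear equation for a series proves its rationality without a
  closed formula.\<close>

lemma rational_in_q_T_divide: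
  assumes "D \<noteq> 0" "series_of_poly D * F = G" "rational_in_q_T G"
  shows "rational_in_q_T F"
proof -
  obtain P D' where "D' \<noteq> 0" "series_of_poly D' * G = series_of_poly P"
    using assms unfolding rational_in_q_T_def by blast
  then have "series_of_poly (D' * D) * F = series_of_poly P" "D' * D \<noteq> 0"
    using assms(1,2) by (auto simp: series_of_poly_mult mult.assoc)
  then show ?thesis unfolding rational_in_q_T_def by blast
qed

lemma rational_in_q_T_0: "rational_in_q_T 0"
  using rational_in_q_T_series_of_poly[of "[:0:]"] unfolding series_of_poly_const by simp

lemma rational_in_q_T_sum:
  assumes "\<And>i. i \<in> A \<Longrightarrow> rational_in_q_T (f i)"
  shows "rational_in_q_T (\<Sum>i\<in>A. f i)"
  using assms
  by (induction A rule: infinite_finite_induct) (auto simp: rational_in_q_T_0 rational_in_q_T_add)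

text \<open>A negative power of \<open>q\<close> is not the image of a polynomial, but it becomes 1
  when multiplied by the opposite power, which serves as its denominator.\<close>

lemma rational_in_q_T_qpow: "rational_in_q_T (fps_const (qpow k))"
proof (cases "k \<ge> 0")
  case True
  then have "fps_const (qpow k) = series_of_poly [:monom 1 (nat k):]"
    by (simp add: series_of_poly_const laurent_of_poly_monom qpow_def)
  then show ?thesis by (simp add: rational_in_q_T_series_of_poly)
next
  case False
  have "series_of_poly [:monom 1 (nat (- k)):] * fps_const (qpow k) = series_of_poly [:1:]"
    using False qpow_add[of "- k" k]
    by (simp add: series_of_poly_const laurent_of_poly_monom flip: qpow_def)
  then show ?thesis
    by (rule rational_in_q_T_divide[rotated])
      (simp_all add: rational_in_q_T_series_of_poly monom_eq_0_iff)
qed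

section \<open>Weights of bases\<close>

lemma sum_indicator:
  assumes "finite B"
  shows "(\<Sum>e\<in>B. of_bool (e \<in> F)) = int (card (B \<inter> F))"
  using assms by (simp add: of_bool_def sum.If_cases)

lemma finite_basis:
  assumes "matroid M" "B \<in> bases M"
  shows "finite B"
  using assms unfolding matroid_def by (meson PowD finite_subset subsetD)

lemma finite_bases:
  assumes "matroid M"
  shows "finite (bases M)"
  using assms by (auto simp: matroid_def intro: finite_subset[of _ "Pow (ground M)"])

lemma sum_basis_le_wt:
  assumes "matroid M" "B \<in> bases M"
  shows "(\<Sum>e\<in>B. w e) \<le> wt M w"
  unfolding wt_def using assms finite_bases[OF assms(1)] by (intro Max_ge) auto

lemma wt_attained:
  assumes "matroid M"
  obtains B where "B \<in> bases M" "(\<Sum>e\<in>B. w e) = wt M w"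
proof -
  have "wt M w \<in> (\<lambda>B. \<Sum>e\<in>B. w e) ` bases M"
    unfolding wt_def using assms finite_bases[OF assms]
    by (intro Max_in) (auto simp: matroid_def)
  then show ?thesis using that by auto
qed

text \<open>The indicator vector of \<open>F\<close> gives a basis \<open>B\<close> the weight
  \<open>card (B \<inter> F)\<close>, so its maximal weight is the rank of \<open>F\<close>. The
  basis \<open>A\<close> attaining it is the target of the exchange argument.\<close>

lemma wt_indicator:
  assumes M: "matroid M"
  obtains A where "A \<in> bases M" "int (card (A \<inter> F)) = wt M (\<lambda>e. of_bool (e \<in> F))"
    "\<And>B. B \<in> bases M \<Longrightarrow> card (B \<inter> F) \<le> card (A \<inter> F)"
proof -
  have s: "(\<Sum>e\<in>B. of_bool (e \<in> F)) = int (card (B \<inter> F))" if "B \<in> bases M" for B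
    using finite_basis[OF M that] by (rule sum_indicator)
  obtain A where A: "A \<in> bases M" "(\<Sum>e\<in>A. of_bool (e \<in> F)) = wt M (\<lambda>e. of_bool (e \<in> F) :: int)"
    using wt_attained[OF M] .
  show ?thesis
  proof (rule that[OF A(1)])
    show "int (card (A \<inter> F)) = wt M (\<lambda>e. of_bool (e \<in> F))" using A s by simp
    then show "card (B \<inter> F) \<le> card (A \<inter> F)" if "B \<in> bases M" for B
      using sum_basis_le_wt[OF M that, of "\<lambda>e. of_bool (e \<in> F) :: int"] s[OF that] by simp
  qed
qed

text \<open>
  Exchanging an element of \<open>B\<close> outside the support \<open>F\<close> of \<open>w\<close> cannot decrease the weight of \<open>B\<close>,
  and moves \<open>B\<close> closer to \<open>A\<close>.
\<close>

lemma max_basis_exchange: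
  fixes w :: "'a \<Rightarrow> 'b::linordered_idom"
  assumes M: "matroid M" and A: "A \<in> bases M"
    and nonneg: "\<And>e. e \<in> ground M \<Longrightarrow> 0 \<le> w e"
    and supp: "\<And>e. e \<in> ground M \<Longrightarrow> e \<notin> F \<Longrightarrow> w e = 0"
    and "B \<in> bases M" "(\<Sum>e\<in>B. w e) = wt M w"
  shows "\<exists>B'\<in>bases M. (\<Sum>e\<in>B'. w e) = wt M w \<and> card (A \<inter> F) \<le> card (B' \<inter> F)"
  using assms(5,6)
proof (induction "card (A - B)" arbitrary: B rule: less_induct)
  case less
  show ?case
  proof (cases "card (A \<inter> F) \<le> card (B \<inter> F)")
    case True
    then show ?thesis using less.prems by blast
  next
    case False
    have fin: "finite A" "finite B" using finite_basis[OF M] A less.prems by auto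
    \<comment> \<open>Bases have equal size, so if \<open>A\<close> meets \<open>F\<close> in more
      elements than \<open>B\<close> does, then \<open>B\<close> has more elements outside
      \<open>F\<close>. This supplies a \<open>y\<close> in \<open>B\<close> of weight 0 that lies
      outside \<open>A\<close>.\<close>
    have "card A = card B" using rank_eq_card_basis[OF M] A less.prems by metis
    moreover have "card A = card (A \<inter> F) + card (A - F)" "card B = card (B \<inter> F) + card (B - F)"
      using fin by (metis card_Int_Diff)+
    ultimately have "card (A - F) < card (B - F)" using False by linarith
    then obtain y where y: "y \<in> B" "y \<notin> F" "y \<notin> A"
      using fin by (metis DiffD1 DiffD2 DiffI card_mono finite_Diff not_less subsetI)
    then obtain x where x: "x \<in> A - B" "insert x (B - {y}) \<in> bases M"
      using M A less.prems unfolding matroid_def by (meson DiffI)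
    have ground: "A \<subseteq> ground M" "B \<subseteq> ground M" using M A less.prems by (auto simp: matroid_def)
    have "(\<Sum>e\<in>insert x (B - {y}). w e) = w x + ((\<Sum>e\<in>B. w e) - w y)"
      using x y fin by (simp add: sum_diff1)
    then have "(\<Sum>e\<in>insert x (B - {y}). w e) \<ge> wt M w"
      using nonneg[of x] supp[of y] x y ground less.prems by (auto simp: subset_iff)
    then have "(\<Sum>e\<in>insert x (B - {y}). w e) = wt M w"
      using sum_basis_le_wt[OF M x(2), of w] by (simp add: order_antisym)
    moreover have "card (A - insert x (B - {y})) < card (A - B)"
      using x y fin by (intro psubset_card_mono) auto
    ultimately show ?thesis using less.hyps x(2) by blast
  qed
qed

context
  fixes M :: "'a basis_system" and w w' :: "'a \<Rightarrow> int" and F :: "'a set"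
  assumes M: "matroid M"
    and nonneg: "\<And>e. e \<in> ground M \<Longrightarrow> 0 \<le> w e"
    and supp: "\<And>e. e \<in> ground M \<Longrightarrow> e \<notin> F \<Longrightarrow> w e = 0"
    and w': "\<And>e. e \<in> ground M \<Longrightarrow> w' e = w e + of_bool (e \<in> F)"
begin

lemma sum_add_indicator:
  assumes "B \<in> bases M"
  shows "(\<Sum>e\<in>B. w' e) = (\<Sum>e\<in>B. w e) + int (card (B \<inter> F))"
proof -
  have "B \<subseteq> ground M" using M assms by (auto simp: matroid_def)
  then have "(\<Sum>e\<in>B. w' e) = (\<Sum>e\<in>B. w e + of_bool (e \<in> F))" using w' by (intro sum.cong) auto
  then show ?thesis using finite_basis[OF M assms] by (simp add: sum.distrib sum_indicator)
qed

text \<open>Some basis is maximal for \<open>w\<close> and for the indicator of \<open>F\<close>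
  simultaneously, so the maximum of the sum is the sum of the maxima. The bases maximal for
  \<open>w'\<close> are then exactly those maximal for both summands.\<close>

lemma wt_add_indicator: "wt M w' = wt M w + wt M (\<lambda>e. of_bool (e \<in> F))"
  and initial_add_indicator: "B \<in> bases (initial M w') \<longleftrightarrow>
    B \<in> bases (initial M w) \<and> (\<forall>A\<in>bases M. card (A \<inter> F) \<le> card (B \<inter> F))"
proof -
  obtain A where A: "A \<in> bases M" "int (card (A \<inter> F)) = wt M (\<lambda>e. of_bool (e \<in> F))"
    "\<And>B. B \<in> bases M \<Longrightarrow> card (B \<inter> F) \<le> card (A \<inter> F)"
    using wt_indicator[OF M] by blast
  obtain B0 where "B0 \<in> bases M" "(\<Sum>e\<in>B0. w e) = wt M w" using wt_attained[OF M] .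
  \<comment> \<open>Exchange towards \<open>A\<close> keeps the weight for \<open>w\<close> maximal
    while reaching the largest possible intersection with \<open>F\<close>; the resulting
    \<open>C\<close> attains both maxima.\<close>
  then obtain C where C: "C \<in> bases M" "(\<Sum>e\<in>C. w e) = wt M w" "card (A \<inter> F) \<le> card (C \<inter> F)"
    using max_basis_exchange[where F = F and w = w, OF M A(1) nonneg supp] by blast
  have cC: "card (C \<inter> F) = card (A \<inter> F)" using C A(3) by (simp add: order_antisym)
  obtain D where D: "D \<in> bases M" "(\<Sum>e\<in>D. w' e) = wt M w'" using wt_attained[OF M] .
  show wt: "wt M w' = wt M w + wt M (\<lambda>e. of_bool (e \<in> F))"
  proof (rule order_antisym)
    show "wt M w' \<le> wt M w + wt M (\<lambda>e. of_bool (e \<in> F))"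
      using sum_add_indicator[OF D(1)] D sum_basis_le_wt[OF M D(1), of w] A by fastforce
    show "wt M w + wt M (\<lambda>e. of_bool (e \<in> F)) \<le> wt M w'"
      using sum_add_indicator[OF C(1)] sum_basis_le_wt[OF M C(1), of w'] C A cC by linarith
  qed
  \<comment> \<open>Each summand on the left is at most the matching summand on the right, so
    equality of the sums forces equality of both.\<close>
  have "(\<Sum>e\<in>B. w e) + int (card (B \<inter> F)) = wt M w + int (card (A \<inter> F)) \<longleftrightarrow>
      (\<Sum>e\<in>B. w e) = wt M w \<and> (\<forall>A\<in>bases M. card (A \<inter> F) \<le> card (B \<inter> F))"
    if "B \<in> bases M" for B
  proof -
    have "(\<forall>A\<in>bases M. card (A \<inter> F) \<le> card (B \<inter> F)) \<longleftrightarrow> card (A \<inter> F) \<le> card (B \<inter> F)"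
      using A le_trans by blast
    then show ?thesis using sum_basis_le_wt[OF M that, of w] A(3)[OF that] by linarith
  qed
  moreover have "B \<in> bases (initial M w') \<longleftrightarrow>
      B \<in> bases M \<and> (\<Sum>e\<in>B. w e) + int (card (B \<inter> F)) = wt M w + int (card (A \<inter> F))"
    using sum_add_indicator[of B] A(2) wt by (auto simp: initial_def)
  ultimately show "B \<in> bases (initial M w') \<longleftrightarrow>
    B \<in> bases (initial M w) \<and> (\<forall>A\<in>bases M. card (A \<inter> F) \<le> card (B \<inter> F))"
    by (auto simp: initial_def)
qed

end

section \<open>Superlevel sets\<close>

text \<open>For finite \<open>E\<close>, a nonnegative \<open>w\<close> is a combination, with
  positive integer coefficients, of the indicators of these sets. The chain is kept and the
  coefficients are forgotten, so only finitely many values occur.\<close>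

definition levels :: "'a set \<Rightarrow> ('a \<Rightarrow> int) \<Rightarrow> 'a set set" where
  "levels E w = (\<lambda>k. {e \<in> E. k \<le> w e}) ` {1..} - {{}}"

lemma levels_eq_empty_iff: "levels E w = {} \<longleftrightarrow> (\<forall>e\<in>E. w e < 1)"
proof
  assume "levels E w = {}"
  moreover have "{e \<in> E. 1 \<le> w e} \<in> levels E w" if "{e \<in> E. 1 \<le> w e} \<noteq> {}"
    using that by (auto simp: levels_def)
  ultimately show "\<forall>e\<in>E. w e < 1" by force
qed (force simp: levels_def)

lemma support_in_levels:
  assumes "levels E w \<noteq> {}"
  shows "{e \<in> E. 1 \<le> w e} \<in> levels E w"
  using assms by (force simp: levels_eq_empty_iff levels_def)

text \<open>Superlevel sets are nested, so the union of a nonempty chain is its largest member. This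
  allows \<open>\<Union> C\<close> to denote the support of every nonnegative weight with chain
  \<open>C\<close>.\<close>

lemma Union_levels: "\<Union> (levels E w) = {e \<in> E. 1 \<le> w e}"
proof
  show "\<Union> (levels E w) \<subseteq> {e \<in> E. 1 \<le> w e}" by (auto simp: levels_def)
  show "{e \<in> E. 1 \<le> w e} \<subseteq> \<Union> (levels E w)" by (auto simp: levels_def)
qed

text \<open>Turns positivity of all coordinates, the condition of the local zeta function, into a
  condition on the chain alone.\<close>

lemma ground_in_levels_iff:
  assumes "E \<noteq> {}"
  shows "E \<in> levels E w \<longleftrightarrow> (\<forall>e\<in>E. 1 \<le> w e)"
proof
  assume "E \<in> levels E w"
  then show "\<forall>e\<in>E. 1 \<le> w e" using Union_levels[of E w] by blast
next
  assume "\<forall>e\<in>E. 1 \<le> w e"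
  then have "{e \<in> E. 1 \<le> w e} = E" by blast
  then show "E \<in> levels E w" using assms by (force simp: levels_def)
qed

text \<open>Threshold 1 for \<open>w'\<close> cuts out \<open>F\<close>, and threshold
  \<open>k + 1\<close> for \<open>w'\<close> cuts out the same set as threshold \<open>k\<close> for
  \<open>w\<close>. Whether \<open>F\<close> already belongs to \<open>levels E w\<close> is left
  open; these two cases become the two terms of the recursion.\<close>

lemma levels_add_indicator:
  assumes "F \<subseteq> E" "F \<noteq> {}"
    and nonneg: "\<And>e. e \<in> E \<Longrightarrow> 0 \<le> w e"
    and supp: "\<And>e. e \<in> E \<Longrightarrow> e \<notin> F \<Longrightarrow> w e = 0"
    and w': "\<And>e. e \<in> E \<Longrightarrow> w' e = w e + of_bool (e \<in> F)"
  shows "levels E w' = insert F (levels E w)"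
proof -
  have 1: "{e \<in> E. 1 \<le> w' e} = F"
    using assms(1) nonneg supp w' by (force simp: of_bool_def split: if_splits)
  have k: "{e \<in> E. k + 1 \<le> w' e} = {e \<in> E. k \<le> w e}" if "1 \<le> k" for k
    using nonneg supp w' that by (force simp: of_bool_def split: if_splits)
  have ints: "{1..} = insert 1 ((\<lambda>k. k + 1) ` {1::int..})"
  proof -
    have "x \<in> (\<lambda>k. k + 1) ` {1::int..}" if "1 \<le> x" "x \<noteq> 1" for x
      using that by (intro image_eqI[of _ _ "x - 1"]) auto
    then show ?thesis by auto
  qed
  have "(\<lambda>k. {e \<in> E. k \<le> w' e}) ` {1..} =
      insert F ((\<lambda>k. {e \<in> E. k + 1 \<le> w' e}) ` {1..})"
    by (subst ints) (simp only: 1 image_insert image_image)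
  also have "\<dots> = insert F ((\<lambda>k. {e \<in> E. k \<le> w e}) ` {1..})"
    using k by (intro arg_cong[of _ _ "insert F"] image_cong) auto
  finally show ?thesis using assms(2) by (auto simp: levels_def)
qed

text \<open>Subtracting the indicator of the support splits off the maximality condition for that
  one set, by \<open>initial_add_indicator\<close>. The induction runs over the total of
  \<open>w\<close>, since the chain itself may stay the same in such a step. The right-hand side
  depends on \<open>w\<close> only through its chain.\<close>

lemma initial_levels:
  fixes w :: "'a \<Rightarrow> int"
  assumes M: "matroid M" and nonneg: "\<And>e. e \<in> ground M \<Longrightarrow> 0 \<le> w e"
  shows "initial M w = M\<lparr>bases := {B \<in> bases M.
    \<forall>F\<in>levels (ground M) w. \<forall>A\<in>bases M. card (A \<inter> F) \<le> card (B \<inter> F)}\<rparr>"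
proof -
  have "B \<in> bases (initial M w) \<longleftrightarrow> B \<in> bases M \<and>
      (\<forall>F\<in>levels (ground M) w. \<forall>A\<in>bases M. card (A \<inter> F) \<le> card (B \<inter> F))" for B
    using nonneg
  proof (induction "nat (\<Sum>e\<in>ground M. w e)" arbitrary: w rule: less_induct)
    case less
    have fin: "finite (ground M)" using M by (simp add: matroid_def)
    show ?case
    proof (cases "levels (ground M) w = {}")
      case True
      then have "w e = 0" if "e \<in> ground M" for e
        using less.prems that by (fastforce simp: levels_eq_empty_iff)
      then have s: "(\<Sum>e\<in>A. w e) = 0" if "A \<in> bases M" for A
        using M that by (intro sum.neutral) (auto simp: matroid_def)
      then have "wt M w = 0" using wt_attained[OF M] by metis
      then show ?thesis using True s by (auto simp: initial_def)
    next
      case False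
      define F where "F = {e \<in> ground M. 1 \<le> w e}"
      define u where "u e = w e - of_bool (e \<in> F)" for e
      have F: "F \<subseteq> ground M" "F \<noteq> {}"
        using support_in_levels[OF False] by (auto simp: F_def levels_def)
      have u: "0 \<le> u e" "e \<notin> F \<Longrightarrow> u e = 0" "w e = u e + of_bool (e \<in> F)" if "e \<in> ground M" for e
        using that less.prems[of e] by (auto simp: u_def F_def)
      have "(\<Sum>e\<in>ground M. u e) < (\<Sum>e\<in>ground M. w e)"
        using F by (intro sum_strict_mono_ex1 fin) (auto simp: u_def)
      moreover have "0 \<le> (\<Sum>e\<in>ground M. u e)" using u by (intro sum_nonneg) auto
      ultimately have "nat (\<Sum>e\<in>ground M. u e) < nat (\<Sum>e\<in>ground M. w e)" by linarith
      from less.hyps[OF this u(1)] show ?thesis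
        using initial_add_indicator[OF M u, of B] levels_add_indicator[OF F u] by auto
    qed
  qed
  then have "bases (initial M w) = {B \<in> bases M.
      \<forall>F\<in>levels (ground M) w. \<forall>A\<in>bases M. card (A \<inter> F) \<le> card (B \<inter> F)}"
    by blast
  then show ?thesis by (simp add: initial_def)
qed

section \<open>The contribution of a chain of superlevel sets\<close>

definition level_weights :: "'a set \<Rightarrow> 'a set set \<Rightarrow> nat \<Rightarrow> ('a \<Rightarrow> int) set" where
  "level_weights E C n =
     {w. w \<in> E \<rightarrow>\<^sub>E {0..} \<and> (\<Sum>e\<in>E. w e) = int n \<and> levels E w = C}"

text \<open>For a chain \<open>C\<close> of nonempty subsets of the ground set this is the product
  over \<open>F\<close> in \<open>C\<close> of x_F / (1 - x_F), where x_F = q^(-wt(1_F)) T^|F|. The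
  characteristic polynomial is constant along \<open>C\<close> and is left out.\<close>

definition level_series :: "'a basis_system \<Rightarrow> 'a set set \<Rightarrow> laurent fps" where
  "level_series M C = Abs_fps (\<lambda>n. \<Sum>w\<in>level_weights (ground M) C n. qpow (- wt M w))"

lemma finite_level_weights:
  assumes "finite E"
  shows "finite (level_weights E C n)"
  using finite_zeta_index[OF assms order_refl] unfolding level_weights_def
  by (rule rev_finite_subset) auto

lemma level_weights_supp:
  assumes "w \<in> level_weights E C n" "e \<in> E" "e \<notin> \<Union> C"
  shows "w e = 0"
proof -
  have "w e \<ge> 0" "\<not> 1 \<le> w e" using assms Union_levels[of E w] by (auto simp: level_weights_def)
  then show ?thesis by linarith
qed

text \<open>The inverse subtracts the indicator of the support \<open>\<Union> C\<close>. The
  support stays in the chain if all its coordinates were at least 2, and otherwise drops out of it;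
  hence the two sets in the domain.\<close>

lemma bij_betw_add_indicator:
  assumes fin: "finite E" and C: "\<Union> C \<in> C" and F: "\<Union> C \<subseteq> E" "\<Union> C \<noteq> {}"
  shows "bij_betw (\<lambda>w. restrict (\<lambda>e. w e + of_bool (e \<in> \<Union> C)) E)
    (level_weights E C n \<union> level_weights E (C - {\<Union> C}) n)
    (level_weights E C (n + card (\<Union> C)))"
    (is "bij_betw ?f ?A ?B")
proof (rule bij_betw_byWitness[where f' = "\<lambda>w. restrict (\<lambda>e. w e - of_bool (e \<in> \<Union> C)) E"])
  define F where "F = \<Union> C"
  note F = F[folded F_def] and C = C[folded F_def]
  have ind: "(\<Sum>e\<in>E. of_bool (e \<in> F)) = int (card F)"
    using sum_indicator[OF fin] F by (simp add: Int_absorb1)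
  show "\<forall>w\<in>?A. restrict (\<lambda>e. ?f w e - of_bool (e \<in> \<Union> C)) E = w"
    by (auto simp: level_weights_def fun_eq_iff PiE_iff extensional_def)
  show "\<forall>w\<in>?B. ?f (restrict (\<lambda>e. w e - of_bool (e \<in> \<Union> C)) E) = w"
    by (auto simp: level_weights_def fun_eq_iff PiE_iff extensional_def)
  show "?f ` ?A \<subseteq> ?B"
  proof clarify
    fix w assume w: "w \<in> ?A"
    have nonneg: "0 \<le> w e" if "e \<in> E" for e using w that by (auto simp: level_weights_def)
    \<comment> \<open>In both sets of the domain the union of the chain is contained in
      \<open>F\<close>.\<close>
    have supp: "w e = 0" if "e \<in> E" "e \<notin> F" for e
      using w level_weights_supp[of w E _ n e] that by (auto simp: F_def)
    have "levels E (?f w) = insert F (levels E w)"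
      using F nonneg supp by (intro levels_add_indicator) (auto simp: F_def)
    then have "levels E (?f w) = C" using w C by (auto simp: level_weights_def F_def)
    moreover have "(\<Sum>e\<in>E. ?f w e) = (\<Sum>e\<in>E. w e) + int (card F)"
      using ind by (simp add: sum.distrib F_def)
    ultimately show "?f w \<in> ?B" using w nonneg by (auto simp: level_weights_def F_def)
  qed
  show "(\<lambda>w. restrict (\<lambda>e. w e - of_bool (e \<in> \<Union> C)) E) ` ?B \<subseteq> ?A"
  proof clarify
    fix w assume w: "w \<in> ?B"
    let ?u = "restrict (\<lambda>e. w e - of_bool (e \<in> \<Union> C)) E"
    assume u_notin: "?u \<notin> level_weights E (C - {\<Union> C}) n"
    have Fw: "F = {e \<in> E. 1 \<le> w e}"
      using w Union_levels[of E w] by (simp add: level_weights_def F_def)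
    have nonneg: "0 \<le> ?u e" if "e \<in> E" for e
      using w that Fw by (auto simp: level_weights_def F_def PiE_iff of_bool_def split: if_splits)
    have supp: "?u e = 0" if "e \<in> E" "e \<notin> F" for e
      using w level_weights_supp[of w E C _ e] that by (auto simp: F_def)
    have "levels E w = insert F (levels E ?u)"
      using F nonneg supp by (intro levels_add_indicator) (auto simp: F_def)
    \<comment> \<open>Inserting \<open>F\<close> into the chain of \<open>?u\<close> gives
      \<open>C\<close>, which determines that chain up to membership of \<open>F\<close>.\<close>
    then have "levels E ?u = C \<or> levels E ?u = C - {F}" using w by (auto simp: level_weights_def)
    moreover have "(\<Sum>e\<in>E. ?u e) = (\<Sum>e\<in>E. w e) - int (card F)"
      using ind by (simp add: sum_subtractf F_def)
    ultimately show "?u \<in> level_weights E C n"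
      using w nonneg u_notin by (auto simp: level_weights_def F_def)
  qed
qed

text \<open>Coefficients are compared along \<open>bij_betw_add_indicator\<close>: adding the
  indicator raises the total by \<open>card (\<Union> C)\<close> and, by additivity, the weight by
  that of the indicator, which the power of \<open>q\<close> on the left cancels.\<close>

lemma level_series_recursion:
  assumes M: "matroid M" and C: "\<Union> C \<in> C" and F: "\<Union> C \<subseteq> ground M" "\<Union> C \<noteq> {}"
  shows "fps_const (qpow (wt M (\<lambda>e. of_bool (e \<in> \<Union> C)))) * level_series M C =
    fps_X ^ card (\<Union> C) * (level_series M C + level_series M (C - {\<Union> C}))"
proof (rule fps_ext)
  fix n
  define F where "F = \<Union> C"
  let ?E = "ground M" and ?m = "wt M (\<lambda>e. of_bool (e \<in> F)) :: int"
  have fin: "finite ?E" using M by (simp add: matroid_def)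
  have ind: "(\<Sum>e\<in>?E. of_bool (e \<in> F)) = int (card F)"
    using sum_indicator[OF fin] F[folded F_def] by (simp add: Int_absorb1)
  have "qpow ?m * (\<Sum>w\<in>level_weights ?E C n. qpow (- wt M w)) =
    (if n < card F then 0 else (\<Sum>w\<in>level_weights ?E C (n - card F). qpow (- wt M w)) +
      (\<Sum>w\<in>level_weights ?E (C - {F}) (n - card F). qpow (- wt M w)))"
  proof (cases "n < card F")
    case True
    \<comment> \<open>An integral weight with support \<open>F\<close> is at least 1 on
      \<open>F\<close>, so its total is at least \<open>card F\<close>.\<close>
    have "level_weights ?E C n = {}"
    proof (rule equals0I)
      fix w assume w: "w \<in> level_weights ?E C n"
      have "F = {e \<in> ?E. 1 \<le> w e}"
        using w Union_levels[of ?E w] by (simp add: level_weights_def F_def)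
      then have "(\<Sum>e\<in>?E. of_bool (e \<in> F)) \<le> (\<Sum>e\<in>?E. w e)"
        using w by (intro sum_mono) (auto simp: level_weights_def PiE_iff of_bool_def)
      then show False using w True ind by (simp add: level_weights_def)
    qed
    then show ?thesis using True by simp
  next
    case False
    define k where "k = n - card F"
    have n: "n = k + card F" using False by (simp add: k_def)
    let ?A = "level_weights ?E C k \<union> level_weights ?E (C - {F}) k"
    let ?f = "\<lambda>w. restrict (\<lambda>e. w e + of_bool (e \<in> F)) ?E"
    have wt: "wt M (?f w) = wt M w + ?m" if "w \<in> ?A" for w
      using that level_weights_supp[of w ?E _ k]
      by (intro wt_add_indicator[OF M]) (auto simp: level_weights_def F_def)
    have "(\<Sum>w\<in>level_weights ?E C n. qpow (- wt M w)) = (\<Sum>w\<in>?A. qpow (- wt M (?f w)))"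
      unfolding n F_def
      by (rule sum.reindex_bij_betw[OF bij_betw_add_indicator[OF fin C F, of k], symmetric])
    also have "qpow ?m * \<dots> = (\<Sum>w\<in>?A. qpow (- wt M w))"
      unfolding sum_distrib_left using wt by (intro sum.cong) (simp_all flip: qpow_add)
    \<comment> \<open>The two sets of weights are disjoint because \<open>F\<close> belongs to
      \<open>C\<close>, so that the chains \<open>C\<close> and \<open>C - {F}\<close>
      differ.\<close>
    also have "\<dots> = (\<Sum>w\<in>level_weights ?E C k. qpow (- wt M w)) +
        (\<Sum>w\<in>level_weights ?E (C - {F}) k. qpow (- wt M w))"
      using C by (intro sum.union_disjoint finite_level_weights fin)
        (auto simp: level_weights_def F_def)
    finally show ?thesis using False by (simp add: k_def)
  qed
  then show "fps_nth (fps_const (qpow (wt M (\<lambda>e. of_bool (e \<in> \<Union> C)))) * level_series M C) n =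
    fps_nth (fps_X ^ card (\<Union> C) * (level_series M C + level_series M (C - {\<Union> C}))) n"
    by (simp add: level_series_def F_def fps_X_power_mult_nth)
qed

text \<open>The recursion is linear in the series of \<open>C\<close>; solving it leaves the series
  of the smaller \<open>C - {\<Union> C}\<close>. A set \<open>C\<close> that is not the chain of
  any weight has series 0.\<close>

lemma rational_in_q_T_level_series:
  assumes M: "matroid M" and "finite C"
  shows "rational_in_q_T (level_series M C)"
  using assms(2)
proof (induction C rule: finite_psubset_induct)
  case (psubset C)
  let ?E = "ground M"
  have fin: "finite ?E" using M by (simp add: matroid_def)
  consider "C = {}" | "\<And>n. level_weights ?E C n = {}"
    | n w where "C \<noteq> {}" "w \<in> level_weights ?E C n" by blast
  then show ?case
  proof cases
    case 1
    \<comment> \<open>Only the zero vector has the empty chain, so the series is a constant.\<close>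
    define z where "z = restrict (\<lambda>_. 0 :: int) ?E"
    have "level_weights ?E C n = (if n = 0 then {z} else {})" for n
    proof -
      have eq: "w = z" if "w \<in> level_weights ?E C n" for w n
      proof
        fix e show "w e = z e"
          using that level_weights_supp[OF that, of e] 1
          by (cases "e \<in> ?E") (auto simp: level_weights_def z_def PiE_iff extensional_def)
      qed
      have "(\<Sum>e\<in>?E. z e) = 0" by (simp add: z_def)
      then have "z \<notin> level_weights ?E C n" if "n \<noteq> 0" using that by (simp add: level_weights_def)
      moreover have "z \<in> level_weights ?E C 0"
        using 1 by (auto simp: level_weights_def z_def levels_eq_empty_iff)
      moreover have "level_weights ?E C n \<subseteq> {z}" using eq by blast
      ultimately show ?thesis by (cases "n = 0") (auto simp: subset_singleton_iff)
    qed
    then have "level_series M C = fps_const (qpow (- wt M z))"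
      by (intro fps_ext) (simp add: level_series_def)
    then show ?thesis by (simp add: rational_in_q_T_qpow)
  next
    case 2
    then have "level_series M C = 0" by (intro fps_ext) (simp add: level_series_def)
    then show ?thesis by (simp add: rational_in_q_T_0)
  next
    case 3
    then have C: "C = levels ?E w" by (simp add: level_weights_def)
    have mem: "\<Union> C \<in> C" using support_in_levels[of ?E w] 3(1) Union_levels[of ?E w] C by simp
    have F: "\<Union> C \<subseteq> ?E" "\<Union> C \<noteq> {}" using mem C by (auto simp: levels_def)
    \<comment> \<open>The exponent of \<open>monom\<close> is a natural number; the weight of an
      indicator is nonnegative, being a sum over some basis, so \<open>nat\<close> loses
      nothing.\<close>
    define m where "m = nat (wt M (\<lambda>e. of_bool (e \<in> \<Union> C)))"
    obtain B where "B \<in> bases M"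
      "(\<Sum>e\<in>B. of_bool (e \<in> \<Union> C)) = wt M (\<lambda>e. of_bool (e \<in> \<Union> C) :: int)"
      using wt_attained[OF M] .
    moreover have "0 \<le> (\<Sum>e\<in>B. of_bool (e \<in> \<Union> C) :: int)" by (intro sum_nonneg) simp
    ultimately have m: "wt M (\<lambda>e. of_bool (e \<in> \<Union> C)) = int m" by (simp add: m_def)
    have k: "card (\<Union> C) > 0" using F fin by (meson card_gt_0_iff finite_subset)
    \<comment> \<open>This is q^m - T^|F| with \<open>F\<close> the support, the factor left after
      collecting the terms in \<open>level_series M C\<close>. As \<open>F\<close> is nonempty, its
      constant term in \<open>T\<close> is q^m, hence nonzero.\<close>
    define D where "D = [:monom (1::int) m:] - monom 1 (card (\<Union> C))"
    have "Polynomial.coeff D 0 \<noteq> 0" using k by (simp add: D_def)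
    then have "D \<noteq> 0" by auto
    moreover have "series_of_poly D * level_series M C =
        fps_X ^ card (\<Union> C) * level_series M (C - {\<Union> C})"
    proof -
      have D: "series_of_poly D = fps_const (qpow (int m)) - fps_X ^ card (\<Union> C)"
        unfolding D_def diff_conv_add_uminus
        by (simp only: series_of_poly_add series_of_poly_minus series_of_poly_const
            series_of_poly_monom laurent_of_poly_monom laurent_of_poly_1 qpow_def) simp
      show ?thesis
        unfolding D using level_series_recursion[OF M mem F, unfolded m]
        by (simp add: algebra_simps)
    qed
    moreover have "rational_in_q_T (fps_X ^ card (\<Union> C) * level_series M (C - {\<Union> C}))"
      using rational_in_q_T_series_of_poly[of "monom 1 (card (\<Union> C))"]
        psubset.IH[of "C - {\<Union> C}"] mem
      by (intro rational_in_q_T_mult) (auto simp: series_of_poly_monom)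
    ultimately show ?thesis by (rule rational_in_q_T_divide)
  qed
qed

text \<open>Grouping by chains writes the series as a finite combination of the
  \<open>level_series\<close>. The parameters cover all three zeta functions: \<open>Q\<close>
  selects the chains, \<open>h\<close> is the ordinary or reduced characteristic polynomial, and
  \<open>k\<close> is the constant part of the exponent.\<close>

lemma rational_in_q_T_initial_sum:
  assumes M: "matroid M"
  shows "rational_in_q_T (Abs_fps (\<lambda>n.
    \<Sum>w | w \<in> ground M \<rightarrow>\<^sub>E {0..} \<and> (\<Sum>e\<in>ground M. w e) = int n \<and> Q (levels (ground M) w).
      laurent_of_poly (h (initial M w)) * qpow (k - wt M w)))"
    (is "rational_in_q_T ?Z")
proof -
  let ?E = "ground M"
  have fin: "finite ?E" using M by (simp add: matroid_def)
  \<comment> \<open>The common value of \<open>initial M w\<close> for all nonnegative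
    \<open>w\<close> with chain \<open>C\<close>, as given by \<open>initial_levels\<close>.\<close>
  define N where "N C = M\<lparr>bases := {B \<in> bases M.
    \<forall>F\<in>C. \<forall>A\<in>bases M. card (A \<inter> F) \<le> card (B \<inter> F)}\<rparr>" for C
  define a where "a C = laurent_of_poly (h (N C)) * qpow k" for C
  define \<C> where "\<C> = {C \<in> Pow (Pow ?E). Q C}"
  have fin\<C>: "finite \<C>" using fin by (simp add: \<C>_def)
  have "?Z = (\<Sum>C\<in>\<C>. fps_const (a C) * level_series M C)"
  proof (rule fps_ext)
    fix n
    let ?W = "{w. w \<in> ?E \<rightarrow>\<^sub>E {0..} \<and> (\<Sum>e\<in>?E. w e) = int n \<and> Q (levels ?E w)}"
    let ?g = "\<lambda>w. laurent_of_poly (h (initial M w)) * qpow (k - wt M w)"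
    have finW: "finite ?W"
      using finite_zeta_index[OF fin order_refl] by (rule rev_finite_subset) auto
    have "levels ?E w \<subseteq> Pow ?E" for w by (auto simp: levels_def)
    then have "(\<Sum>w\<in>?W. ?g w) = (\<Sum>C\<in>\<C>. \<Sum>w | w \<in> ?W \<and> levels ?E w = C. ?g w)"
      by (intro sum.group[symmetric] finW fin\<C>) (auto simp: \<C>_def)
    also have "\<dots> = (\<Sum>C\<in>\<C>. a C * (\<Sum>w\<in>level_weights ?E C n. qpow (- wt M w)))"
    proof (rule sum.cong[OF refl])
      fix C assume C: "C \<in> \<C>"
      have "?g w = a C * qpow (- wt M w)" if "w \<in> level_weights ?E C n" for w
      proof -
        have "initial M w = N (levels ?E w)" unfolding N_def
          using that by (intro initial_levels[OF M]) (auto simp: level_weights_def)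
        then show ?thesis
          using that by (simp add: a_def level_weights_def mult.assoc flip: qpow_add)
      qed
      moreover have "{w. w \<in> ?W \<and> levels ?E w = C} = level_weights ?E C n"
        using C by (auto simp: level_weights_def \<C>_def)
      ultimately show "(\<Sum>w | w \<in> ?W \<and> levels ?E w = C. ?g w) =
          a C * (\<Sum>w\<in>level_weights ?E C n. qpow (- wt M w))"
        by (simp add: sum_distrib_left)
    qed
    finally show "fps_nth ?Z n = fps_nth (\<Sum>C\<in>\<C>. fps_const (a C) * level_series M C) n"
      by (simp add: fps_sum_nth level_series_def)
  qed
  moreover have "rational_in_q_T (fps_const (a C) * level_series M C)" if "C \<in> \<C>" for C
  proof -
    have "finite C" using that fin by (auto simp: \<C>_def intro: finite_subset[of _ "Pow ?E"])
    moreover have "rational_in_q_T (fps_const (a C))"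
      using rational_in_q_T_mult[OF rational_in_q_T_series_of_poly[of "[:h (N C):]"]
          rational_in_q_T_qpow[of k]]
      by (simp add: a_def series_of_poly_const)
    ultimately show ?thesis by (intro rational_in_q_T_mult rational_in_q_T_level_series M)
  qed
  ultimately show ?thesis by (simp add: rational_in_q_T_sum)
qed

section \<open>Normalized representatives\<close>

text \<open>The minimum of a nonnegative integral vector is 0 or at least 1, and the latter puts the
  whole ground set into the chain.\<close>

lemma Min_eq_0_iff_levels:
  fixes w :: "'a \<Rightarrow> int"
  assumes "finite E" "E \<noteq> {}" "w \<in> E \<rightarrow>\<^sub>E {0..}"
  shows "Min (w ` E) = 0 \<longleftrightarrow> E \<notin> levels E w"
proof -
  have "0 \<le> Min (w ` E)" using assms by auto
  then have "Min (w ` E) = 0 \<longleftrightarrow> \<not> 1 \<le> Min (w ` E)" by linarith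
  then show ?thesis using assms by (simp add: ground_in_levels_iff)
qed

text \<open>Each class has exactly one representative of minimum 0: subtracting the minimum produces
  one, and a shift by \<open>c\<close> moves the minimum by \<open>c\<close>, so two of them
  coincide.\<close>

lemma bij_betw_normalized:
  assumes fin: "finite E" and E: "E \<noteq> {}"
  shows "bij_betw (\<lambda>w. shift_rel E `` {w})
    {w. w \<in> E \<rightarrow>\<^sub>E {0..} \<and> E \<notin> levels E w} (weights_mod_ones E)"
proof (rule bij_betwI')
  let ?W = "{w. w \<in> E \<rightarrow>\<^sub>E {0..} \<and> E \<notin> levels E w}"
  fix w w' assume w: "w \<in> ?W" "w' \<in> ?W"
  show "shift_rel E `` {w} = shift_rel E `` {w'} \<longleftrightarrow> w = w'"
  proof
    assume "shift_rel E `` {w} = shift_rel E `` {w'}"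
    moreover have "w' \<in> E \<rightarrow>\<^sub>E UNIV" using w by (auto simp: PiE_iff)
    ultimately have "(w, w') \<in> shift_rel E"
      using eq_equiv_class[OF _ equiv_shift_rel] by blast
    then obtain c where c: "\<forall>e\<in>E. w' e = w e + c" by (auto simp: shift_rel_def)
    then have "w' ` E = (\<lambda>e. w e + c) ` E" by auto
    then have "Min (w' ` E) = Min (w ` E) + c" using Min_add_commute[OF fin E] by simp
    moreover have "Min (w ` E) = 0" "Min (w' ` E) = 0"
      using w Min_eq_0_iff_levels[OF fin E] by blast+
    ultimately have "c = 0" by simp
    then show "w = w'" using c w by (intro PiE_ext[of w E "\<lambda>_. {0..}" w']) auto
  qed simp
next
  fix w assume "w \<in> {w. w \<in> E \<rightarrow>\<^sub>E {0..} \<and> E \<notin> levels E w}"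
  then have "w \<in> E \<rightarrow>\<^sub>E UNIV" by (auto simp: PiE_iff)
  then show "shift_rel E `` {w} \<in> weights_mod_ones E"
    unfolding weights_mod_ones_def by (rule quotientI)
next
  fix v assume "v \<in> weights_mod_ones E"
  then obtain u where u: "u \<in> E \<rightarrow>\<^sub>E UNIV" "v = shift_rel E `` {u}"
    by (auto simp: weights_mod_ones_def elim: quotientE)
  define m where "m = Min (u ` E)"
  define w where "w = restrict (\<lambda>e. u e - m) E"
  have "(u, w) \<in> shift_rel E"
    using u by (auto simp: shift_rel_def w_def intro!: exI[of _ "- m"])
  then have "v = shift_rel E `` {w}" using equiv_class_eq[OF equiv_shift_rel] u by metis
  moreover have w: "w \<in> E \<rightarrow>\<^sub>E {0..}" using fin by (auto simp: w_def m_def)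
  moreover have "w ` E = (\<lambda>e. u e + (- m)) ` E" by (auto simp: w_def)
  then have "Min (w ` E) = 0" using Min_add_commute[OF fin E, of u "- m"] by (simp add: m_def)
  ultimately show "\<exists>w\<in>{w. w \<in> E \<rightarrow>\<^sub>E {0..} \<and> E \<notin> levels E w}. v = shift_rel E `` {w}"
    using Min_eq_0_iff_levels[OF fin E w] by blast
qed

text \<open>By \<open>lift_independent\<close> the chosen lift may be replaced by the representative
  of minimum 0, for which the correction terms in \<open>red_wt\<close> and \<open>red_size\<close>
  vanish.\<close>

lemma red_motivic_zeta_normalized:
  assumes M: "matroid M" and E: "ground M \<noteq> {}"
  shows "red_motivic_zeta M = Abs_fps (\<lambda>n.
    \<Sum>w | w \<in> ground M \<rightarrow>\<^sub>E {0..} \<and> (\<Sum>e\<in>ground M. w e) = int n \<and>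
        ground M \<notin> levels (ground M) w.
      laurent_of_poly (red_char_poly (initial M w)) * qpow (- (int (rank M) - 1) - wt M w))"
proof (rule fps_ext)
  fix n
  let ?E = "ground M" and ?cl = "\<lambda>w. shift_rel (ground M) `` {w}"
  let ?W = "{w. w \<in> ?E \<rightarrow>\<^sub>E {0..} \<and> (\<Sum>e\<in>?E. w e) = int n \<and> ?E \<notin> levels ?E w}"
  let ?V = "{v. v \<in> weights_mod_ones ?E \<and> red_size ?E v = int n}"
  let ?g = "\<lambda>v. laurent_of_poly (red_char_poly (initial M (lift v)))
    * qpow (- (int (rank M) - 1) - red_wt M v)"
  have fin: "finite ?E" using M by (simp add: matroid_def)
  note bij = bij_betw_normalized[OF fin E]
  have cl: "red_wt M (?cl w) = wt M w" "red_size ?E (?cl w) = (\<Sum>e\<in>?E. w e)"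
    "initial M (lift (?cl w)) = initial M w"
    if w: "w \<in> ?E \<rightarrow>\<^sub>E {0..}" "?E \<notin> levels ?E w" for w
  proof -
    have v: "?cl w \<in> weights_mod_ones ?E" using bij_betwE[OF bij] w by blast
    have "w \<in> ?E \<rightarrow>\<^sub>E UNIV" using w by (auto simp: PiE_iff)
    then have "w \<in> ?cl w" by (rule equiv_class_self[OF equiv_shift_rel])
    note l = lift_independent[OF M E v this]
    show "red_wt M (?cl w) = wt M w" "red_size ?E (?cl w) = (\<Sum>e\<in>?E. w e)"
      "initial M (lift (?cl w)) = initial M w"
      using l w Min_eq_0_iff_levels[OF fin E w(1)] by simp_all
  qed
  have "?cl ` ?W = ?V"
  proof
    show "?cl ` ?W \<subseteq> ?V" using bij_betwE[OF bij] cl(2) by auto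
    show "?V \<subseteq> ?cl ` ?W"
    proof clarify
      fix v assume v: "v \<in> weights_mod_ones ?E" "red_size ?E v = int n"
      then obtain w where "w \<in> ?E \<rightarrow>\<^sub>E {0..}" "?E \<notin> levels ?E w" "v = ?cl w"
        using bij_betw_imp_surj_on[OF bij] by blast
      then show "v \<in> ?cl ` ?W" using v(2) cl(2) by auto
    qed
  qed
  moreover have "inj_on ?cl ?W" by (rule inj_on_subset[OF bij_betw_imp_inj_on[OF bij]]) auto
  ultimately have "bij_betw ?cl ?W ?V" by (simp add: bij_betw_def)
  then have "(\<Sum>v\<in>?V. ?g v) = (\<Sum>w\<in>?W. ?g (?cl w))" by (rule sum.reindex_bij_betw[symmetric])
  also have "\<dots> = (\<Sum>w\<in>?W. laurent_of_poly (red_char_poly (initial M w))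
      * qpow (- (int (rank M) - 1) - wt M w))"
    using cl by (intro sum.cong) auto
  finally show "fps_nth (red_motivic_zeta M) n = fps_nth (Abs_fps (\<lambda>n.
    \<Sum>w | w \<in> ?E \<rightarrow>\<^sub>E {0..} \<and> (\<Sum>e\<in>?E. w e) = int n \<and> ?E \<notin> levels ?E w.
      laurent_of_poly (red_char_poly (initial M w)) * qpow (- (int (rank M) - 1) - wt M w))) n"
    by (simp add: red_motivic_zeta_def)
qed

theorem theorem1p1:
  fixes M :: "'a basis_system"
  assumes "matroid M" and "ground M \<noteq> {}"
  shows "rational_in_q_T (motivic_zeta M)
    \<and> rational_in_q_T (local_motivic_zeta M)
    \<and> rational_in_q_T (red_motivic_zeta M)"
proof (intro conjI)
  show "rational_in_q_T (motivic_zeta M)"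
    using rational_in_q_T_initial_sum[OF assms(1), where Q = "\<lambda>_. True"]
    by (simp add: motivic_zeta_def zeta_sum_def)
  \<comment> \<open>For integers, positive means at least 1, so the superlevel set at threshold 1 is
    the whole ground set.\<close>
  have "w \<in> ground M \<rightarrow>\<^sub>E {0<..} \<longleftrightarrow>
      w \<in> ground M \<rightarrow>\<^sub>E {0..} \<and> ground M \<in> levels (ground M) w" for w
    using assms(2) by (force simp: ground_in_levels_iff PiE_iff)
  then have "w \<in> ground M \<rightarrow>\<^sub>E {0<..} \<and> (\<Sum>e\<in>ground M. w e) = int n \<longleftrightarrow>
      w \<in> ground M \<rightarrow>\<^sub>E {0..} \<and> (\<Sum>e\<in>ground M. w e) = int n \<and> ground M \<in> levels (ground M) w"
    for w n by blast
  then show "rational_in_q_T (local_motivic_zeta M)"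
    using rational_in_q_T_initial_sum[OF assms(1), where Q = "\<lambda>C. ground M \<in> C"]
    by (simp add: local_motivic_zeta_def zeta_sum_def)
  \<comment> \<open>The chains that avoid the ground set are selected, with
    \<open>red_char_poly\<close> as \<open>h\<close> and the exponent shifted to that of rank one
    less.\<close>
  show "rational_in_q_T (red_motivic_zeta M)"
    unfolding red_motivic_zeta_normalized[OF assms]
    by (rule rational_in_q_T_initial_sum[OF assms(1)])
qed

end
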